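(* Let $\Psi=(E,\Delta)$ be an ordered simplicial complex in the class QI, with lexicographically smallest basis $B_0$, and let $A\subseteq E$ be a subset such that $\operatorname{rk}(A)=|B_0\cap A|$. Then the restriction $\Psi|_A$ is pure.
   Context: An ordered simplicial complex is a pair $\Psi=(E,\Delta)$ with $E$ a finite totally ordered set and $\Delta\subseteq 2^E$ a simplicial complex (closed under taking subsets, $\emptyset\in\Delta$). Elements of $\Delta$ are independent sets; inclusion-maximal ones are bases. $\Psi$ is pure if all bases have the same cardinality. The rank $\operatorname{rk}(A)$ of $A\subseteq E$ is the maximum cardinality of an independent set contained in $A$. The restriction is $\Psi|_A=(A,\{I\in\Delta: I\subseteq A\})$. The lexicographic order on subsets of $E$ is the dictionary order on increasingly sorted lists. For an independent set $I$, the contraction of $I$ is the ordered complex on $E\setminus I$ with independent sets $\{J\subseteq E\setminus I: J\cup I\in\Delta\}$, and $B_{I,0}$ denotes its lexicographically smallest basis (so $B_{\emptyset,0}=B_0$). QI: the class of $\Psi$ that are pure and such that for all independent $I_1,I_2$ with $|I_1|>|I_2|$, if $I_1\setminus I\subseteq B_{I,0}$ for some $I\subseteq I_1\cap I_2$, then there is $e\in I_1\setminus I_2$ with $I_2\cup\{e\}\in\Delta$. *)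

theory Defs
  imports Main
begin

text \<open>
  An ordered simplicial complex is a pair of a finite ground set and its family of
  independent sets.  The total order on the ground set is the one it inherits from the
  ambient linearly ordered type.
\<close>

type_synonym 'a ordered_complex = "'a set \<times> 'a set set"

definition ground :: "'a ordered_complex \<Rightarrow> 'a set" where
  "ground \<Psi> = fst \<Psi>"

definition indep :: "'a ordered_complex \<Rightarrow> 'a set set" where
  "indep \<Psi> = snd \<Psi>"

definition ordered_simplicial_complex :: "'a::linorder ordered_complex \<Rightarrow> bool" where
  "ordered_simplicial_complex \<Psi> \<longleftrightarrow>
     finite (ground \<Psi>) \<and> indep \<Psi> \<subseteq> Pow (ground \<Psi>) \<and> {} \<in> indep \<Psi> \<and>
     (\<forall>I \<in> indep \<Psi>. \<forall>J. J \<subseteq> I \<longrightarrow> J \<in> indep \<Psi>)"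

definition bases :: "'a ordered_complex \<Rightarrow> 'a set set" where
  "bases \<Psi> = {B \<in> indep \<Psi>. \<forall>I \<in> indep \<Psi>. B \<subseteq> I \<longrightarrow> B = I}"

definition pure :: "'a ordered_complex \<Rightarrow> bool" where
  "pure \<Psi> \<longleftrightarrow> (\<forall>B \<in> bases \<Psi>. \<forall>B' \<in> bases \<Psi>. card B = card B')"

definition rk :: "'a ordered_complex \<Rightarrow> 'a set \<Rightarrow> nat" where
  "rk \<Psi> A = Max (card ` {I \<in> indep \<Psi>. I \<subseteq> A})"

definition restriction :: "'a ordered_complex \<Rightarrow> 'a set \<Rightarrow> 'a ordered_complex" where
  "restriction \<Psi> A = (A, {I \<in> indep \<Psi>. I \<subseteq> A})"

definition contraction :: "'a ordered_complex \<Rightarrow> 'a set \<Rightarrow> 'a ordered_complex" where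
  "contraction \<Psi> I = (ground \<Psi> - I, {J. J \<subseteq> ground \<Psi> - I \<and> J \<union> I \<in> indep \<Psi>})"

definition lex_le :: "'a::linorder set \<Rightarrow> 'a set \<Rightarrow> bool" where
  "lex_le A B \<longleftrightarrow> ord_class.lexordp_eq (sorted_list_of_set A) (sorted_list_of_set B)"

definition lex_min_basis :: "'a::linorder ordered_complex \<Rightarrow> 'a set" where
  "lex_min_basis \<Psi> = (THE B. B \<in> bases \<Psi> \<and> (\<forall>B' \<in> bases \<Psi>. lex_le B B'))"

definition QI :: "'a::linorder ordered_complex set" where
  "QI = {\<Psi>. ordered_simplicial_complex \<Psi> \<and> pure \<Psi> \<and>
     (\<forall>I1 \<in> indep \<Psi>. \<forall>I2 \<in> indep \<Psi>.
        card I1 > card I2 \<longrightarrow>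
        (\<exists>I. I \<subseteq> I1 \<inter> I2 \<and> I1 - I \<subseteq> lex_min_basis (contraction \<Psi> I)) \<longrightarrow>
        (\<exists>e \<in> I1 - I2. I2 \<union> {e} \<in> indep \<Psi>))}"

text \<open>
  The definite description in the definition of the lexicographically smallest basis is
  always meaningful: an ordered simplicial complex has exactly one such basis, and
  contracting an independent set yields an ordered simplicial complex again.
\<close>

lemma ordered_simplicial_complex_contraction:
  assumes "ordered_simplicial_complex \<Psi>" and "I \<in> indep \<Psi>"
  shows "ordered_simplicial_complex (contraction \<Psi> I)"
proof -
  have down: "Y \<in> indep \<Psi>" if "X \<in> indep \<Psi>" "Y \<subseteq> X" for X Y
    using assms(1) that by (simp add: ordered_simplicial_complex_def)
  have "K \<union> I \<in> indep \<Psi>" if "J \<union> I \<in> indep \<Psi>" "K \<subseteq> J" for J K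
    using down[OF that(1), of "K \<union> I"] that(2) by blast
  moreover have "finite (ground \<Psi>)"
    using assms(1) by (simp add: ordered_simplicial_complex_def)
  ultimately show ?thesis
    using assms(2)
    by (auto simp: ordered_simplicial_complex_def contraction_def ground_def indep_def)
qed

lemma finite_lex_min:
  fixes S :: "'a::linorder set set"
  assumes "finite S" and "S \<noteq> {}"
  shows "\<exists>B \<in> S. \<forall>B' \<in> S. lex_le B B'"
  using assms
proof (induction S rule: finite_ne_induct)
  case (singleton x)
  then show ?case by (simp add: lex_le_def lexordp_eq_refl)
next
  case (insert x F)
  then obtain B where B: "B \<in> F" "\<forall>B' \<in> F. lex_le B B'" by blast
  have lin: "lex_le x B \<or> lex_le B x"
    unfolding lex_le_def by (rule lexordp_eq_linear)
  have tr: "lex_le X Z" if "lex_le X Y" "lex_le Y Z" for X Y Z :: "'a set"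
    using that unfolding lex_le_def by (rule lexordp_eq_trans)
  have refl: "lex_le x x" by (simp add: lex_le_def lexordp_eq_refl)
  from lin show ?case
  proof
    assume "lex_le x B"
    with B(2) have "\<forall>B' \<in> F. lex_le x B'" using tr by blast
    with refl show ?thesis by blast
  next
    assume "lex_le B x"
    with B show ?thesis by blast
  qed
qed

lemma lex_min_basis_ex1:
  assumes "ordered_simplicial_complex \<Psi>"
  shows "\<exists>!B. B \<in> bases \<Psi> \<and> (\<forall>B' \<in> bases \<Psi>. lex_le B B')"
proof -
  have gr: "finite (ground \<Psi>)" and sub: "indep \<Psi> \<subseteq> Pow (ground \<Psi>)"
    using assms by (simp_all add: ordered_simplicial_complex_def)
  have fin: "finite (indep \<Psi>)" by (rule finite_subset[OF sub]) (simp add: gr)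
  have fin_el: "finite X" if "X \<in> indep \<Psi>" for X
    using sub that gr by (meson PowD finite_subset subsetD)
  have ne: "{} \<in> indep \<Psi>" using assms by (simp add: ordered_simplicial_complex_def)
  have finB: "finite (bases \<Psi>)" using fin unfolding bases_def by simp
  obtain M where "M \<in> indep \<Psi>" "\<forall>b \<in> indep \<Psi>. M \<subseteq> b \<longrightarrow> M = b"
    using finite_has_maximal[OF fin] ne by blast
  then have "bases \<Psi> \<noteq> {}" unfolding bases_def by blast
  then obtain B where B: "B \<in> bases \<Psi>" "\<forall>B' \<in> bases \<Psi>. lex_le B B'"
    using finite_lex_min[OF finB] by blast
  have "C = B" if C: "C \<in> bases \<Psi>" "\<forall>B' \<in> bases \<Psi>. lex_le C B'" for C
  proof -
    have "sorted_list_of_set C = sorted_list_of_set B"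
      using B C unfolding lex_le_def by (meson lexordp_eq_antisym)
    moreover have "finite C" "finite B" using B C fin_el unfolding bases_def by auto
    ultimately show ?thesis by (metis set_sorted_list_of_set)
  qed
  with B show ?thesis by blast
qed

end

theory Submission
  imports Defs
begin

text \<open>
  The independent set \<^term>\<open>B\<^sub>0 \<inter> A\<close> lies in the lexicographically smallest basis, so the
  exchange property with \<^term>\<open>I = {}\<close> adds an element of it to every smaller independent
  subset of \<^term>\<open>A\<close>.  Since \<^term>\<open>B\<^sub>0 \<inter> A\<close> has the maximal cardinality, all bases of the
  restriction have this cardinality.
\<close>

text \<open>Independent sets already lie in the ground set, so nothing is filtered out. This turns
  the condition of \<open>QI\<close> at \<open>I = {}\<close> into one on
  \<open>lex_min_basis \<Psi>\<close>.\<close>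

lemma contraction_empty:
  assumes "ordered_simplicial_complex \<Psi>"
  shows "contraction \<Psi> {} = \<Psi>"
  using assms
  by (cases \<Psi>) (auto simp: ordered_simplicial_complex_def contraction_def ground_def indep_def)

lemma lex_min_basis_indep:
  assumes "ordered_simplicial_complex \<Psi>"
  shows "lex_min_basis \<Psi> \<in> indep \<Psi>"
  using theI'[OF lex_min_basis_ex1[OF assms]]
  unfolding lex_min_basis_def bases_def by blast

lemma card_le_rk:
  assumes "ordered_simplicial_complex \<Psi>" and "I \<in> indep \<Psi>" and "I \<subseteq> A"
  shows "card I \<le> rk \<Psi> A"
proof -
  have "finite (indep \<Psi>)"
    using assms(1) by (auto simp: ordered_simplicial_complex_def intro: finite_subset)
  then show ?thesis
    using assms(2,3) unfolding rk_def by (intro Max_ge) auto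
qed

theorem theorem4p6:
  fixes \<Psi> :: "'a::linorder ordered_complex"
    and A :: "'a set"
  assumes "\<Psi> \<in> QI"
    and "A \<subseteq> ground \<Psi>"
    and "rk \<Psi> A = card (lex_min_basis \<Psi> \<inter> A)"
  shows "pure (restriction \<Psi> A)"
proof -
  define I1 where "I1 = lex_min_basis \<Psi> \<inter> A"
  have osc: "ordered_simplicial_complex \<Psi>"
    using assms(1) by (simp add: QI_def)
  have I1: "I1 \<in> indep \<Psi>"
    using osc lex_min_basis_indep[OF osc] unfolding I1_def ordered_simplicial_complex_def by blast
  have exch: "\<exists>e \<in> I1 - I2. I2 \<union> {e} \<in> indep \<Psi>"
    if "I2 \<in> indep \<Psi>" "card I2 < card I1" for I2
  proof -
    have "\<exists>I. I \<subseteq> I1 \<inter> I2 \<and> I1 - I \<subseteq> lex_min_basis (contraction \<Psi> I)"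
      by (rule exI[of _ "{}"]) (simp add: contraction_empty[OF osc] I1_def)
    then show ?thesis
      using assms(1) I1 that unfolding QI_def by blast
  qed
  have "card B = rk \<Psi> A" if "B \<in> bases (restriction \<Psi> A)" for B
  proof -
    have B: "B \<in> indep \<Psi>" "B \<subseteq> A"
      and max: "\<And>J. J \<in> indep \<Psi> \<Longrightarrow> J \<subseteq> A \<Longrightarrow> B \<subseteq> J \<Longrightarrow> B = J"
      using that by (auto simp: bases_def restriction_def indep_def)
    have "\<not> card B < card I1"
    proof
      assume "card B < card I1"
      then obtain e where "e \<in> I1 - B" "B \<union> {e} \<in> indep \<Psi>"
        using exch B(1) by blast
      \<comment> \<open>Since \<open>I1\<close> lies in \<open>A\<close>, so does
        \<open>B \<union> {e}\<close>, against the maximality of \<open>B\<close> within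
        \<open>A\<close>.\<close>
      then show False
        using max[of "B \<union> {e}"] B(2) unfolding I1_def by blast
    qed
    \<comment> \<open>By assumption \<open>card I1\<close> is the rank, so the lower and upper
      bounds meet.\<close>
    then show ?thesis
      using card_le_rk[OF osc B] assms(3) by (simp add: I1_def)
  qed
  then show ?thesis by (simp add: pure_def)
qed

end
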